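(* Let $b_0,b_1,b_2,\ldots$ and $\lambda_1,\lambda_2,\ldots$ be independent indeterminates and let $\mathbb{Z}[b,\lambda]=\mathbb{Z}[b_0,b_1,\ldots,\lambda_1,\lambda_2,\ldots]$. For $m\geq 0$ let $\mu_m=\sum_\omega \mathrm{wt}(\omega)\in\mathbb{Z}[b,\lambda]$, the sum over all Motzkin paths $\omega$ of length $m$ with $\omega(1)=\omega(m+1)=0$. Then for every $n\geq 0$ the Hankel matrix $(\mu_{i+j})_{0\leq i,j\leq n}$ has special Smith normal form $\mathrm{diag}(1,\lambda_1,\lambda_1\lambda_2,\ldots,\lambda_1\lambda_2\cdots\lambda_n)$ over $\mathbb{Z}[b,\lambda]$.
   Context: A Motzkin path of length $m$ is a map $\omega:\{1,2,\ldots,m+1\}\to\mathbb{N}=\{0,1,2,\ldots\}$ such that $|\omega(i+1)-\omega(i)|\leq 1$ for $1\leq i\leq m$. Its weight is $\mathrm{wt}(\omega)=\prod_i b_{\omega(i)}\prod_j \lambda_{\omega(j)}$, where the first product is over all $i\in\{1,\ldots,m\}$ with $\omega(i+1)=\omega(i)$ and the second over all $j\in\{1,\ldots,m\}$ with $\omega(j+1)-\omega(j)=-1$. For an $m\times n$ matrix $A$ over a commutative ring $R$, a matrix $D$ is a special Smith normal form (SSNF) of $A$ over $R$ if there exist $P\in \mathrm{SL}(m,R)$ and $Q\in\mathrm{SL}(n,R)$ (square matrices over $R$ of determinant $1$) with $PAQ=D$, $D$ is diagonal ($D_{ij}=0$ for $i\neq j$), and the diagonal entry $d_{ii}$ is a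 multiple in $R$ of $d_{jj}$ whenever $i\geq j$. *)

theory Defs
  imports "HOL-Library.Poly_Mapping" "HOL-Library.FuncSet"
    "Jordan_Normal_Form.Determinant"
begin

(* VarB k is the indeterminate b_k and VarL k is the indeterminate lambda_(k+1);
   there is no indeterminate lambda_0. *)
datatype indet = VarB nat | VarL nat

(* The polynomial ring Z[b, lambda]: finitely supported integer combinations of monomials,
   a monomial being a finitely supported exponent vector. *)
type_synonym poly_b_lambda = "(indet \<Rightarrow>\<^sub>0 nat) \<Rightarrow>\<^sub>0 int"

definition var :: "indet \<Rightarrow> poly_b_lambda" where
  "var x = Poly_Mapping.single (Poly_Mapping.single x 1) 1"

definition b :: "nat \<Rightarrow> poly_b_lambda" where
  "b k = var (VarB k)"

(* Meant for k >= 1 only; b and lam enumerate the indeterminates b_0, b_1, ... and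
   lambda_1, lambda_2, .... The value lam 0 is an irrelevant by-product of truncated
   subtraction: a down step starts at a positive height. *)
definition lam :: "nat \<Rightarrow> poly_b_lambda" where
  "lam k = var (VarL (k - 1))"

(* Extensional functions, so that each map on {1..m+1} is represented exactly once. *)
definition motzkin_paths :: "nat \<Rightarrow> (nat \<Rightarrow> nat) set" where
  "motzkin_paths m =
     {\<omega> \<in> {1..m+1} \<rightarrow>\<^sub>E (UNIV :: nat set).
        \<forall>i\<in>{1..m}. \<bar>int (\<omega> (i+1)) - int (\<omega> i)\<bar> \<le> 1}"

definition wt :: "nat \<Rightarrow> (nat \<Rightarrow> nat) \<Rightarrow> poly_b_lambda" where
  "wt m \<omega> =
     (\<Prod>i\<in>{i\<in>{1..m}. \<omega> (i+1) = \<omega> i}. b (\<omega> i)) *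
     (\<Prod>j\<in>{j\<in>{1..m}. int (\<omega> (j+1)) - int (\<omega> j) = -1}. lam (\<omega> j))"

definition closed_motzkin_paths :: "nat \<Rightarrow> (nat \<Rightarrow> nat) set" where
  "closed_motzkin_paths m = {\<omega> \<in> motzkin_paths m. \<omega> 1 = 0 \<and> \<omega> (m+1) = 0}"

definition \<mu> :: "nat \<Rightarrow> poly_b_lambda" where
  "\<mu> m = (\<Sum>\<omega>\<in>closed_motzkin_paths m. wt m \<omega>)"

(* The sum defining \<mu> is a genuine finite sum. *)
lemma finite_closed_motzkin_paths: "finite (closed_motzkin_paths m)"
proof (rule finite_subset)
  show "closed_motzkin_paths m \<subseteq> {1..m+1} \<rightarrow>\<^sub>E {..m}"
  proof
    fix \<omega> assume "\<omega> \<in> closed_motzkin_paths m"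
    then have ext: "\<omega> \<in> {1..m+1} \<rightarrow>\<^sub>E UNIV" and start: "\<omega> 1 = 0"
      and step: "\<And>i. 1 \<le> i \<Longrightarrow> i \<le> m \<Longrightarrow> \<bar>int (\<omega> (i+1)) - int (\<omega> i)\<bar> \<le> 1"
      by (auto simp: closed_motzkin_paths_def motzkin_paths_def)
    have bound: "\<omega> (k+1) \<le> k" if "k \<le> m" for k
      using that
    proof (induction k)
      case 0
      then show ?case using start by simp
    next
      case (Suc k)
      then show ?case using step[of "k+1"] by simp
    qed
    have "\<omega> i \<le> m" if "i \<in> {1..m+1}" for i
      using bound[of "i - 1"] that by force
    then show "\<omega> \<in> {1..m+1} \<rightarrow>\<^sub>E {..m}"
      using ext by (auto simp: PiE_iff)
  qed
qed (simp add: finite_PiE)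

definition hankel :: "(nat \<Rightarrow> 'a) \<Rightarrow> nat \<Rightarrow> 'a mat" where
  "hankel a n = mat (n+1) (n+1) (\<lambda>(i, j). a (i + j))"

definition SL :: "nat \<Rightarrow> 'a::comm_ring_1 mat set" where
  "SL m = {P \<in> carrier_mat m m. det P = 1}"

definition is_SSNF :: "'a::comm_ring_1 mat \<Rightarrow> 'a mat \<Rightarrow> bool" where
  "is_SSNF A D \<longleftrightarrow>
     (\<exists>P\<in>SL (dim_row A). \<exists>Q\<in>SL (dim_col A). P * A * Q = D) \<and>
     diagonal_mat D \<and>
     (\<forall>i j. j \<le> i \<and> i < min (dim_row D) (dim_col D) \<longrightarrow> D $$ (j, j) dvd D $$ (i, i))"

end

theory Submission
  imports Defs
begin

text \<open>Let \<open>L (m, k)\<close> be the total weight of the Motzkin paths of length \<open>m\<close> from height \<open>0\<close> to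
  height \<open>k\<close>; it is lower unitriangular. The transfer matrix of a single step is tridiagonal and
  becomes symmetric after rescaling by \<open>\<Lambda> k = \<lambda>\<^sub>1 \<cdots> \<lambda>\<^sub>k\<close>, so powers of it can be moved from one side
  of the form \<open>\<Sum>k. L (i, k) * \<Lambda> k * L (j, k)\<close> to the other. Hence this form equals
  \<open>L (i + j, 0) = \<mu> (i + j)\<close>, that is, the Hankel matrix is \<open>L * diag \<Lambda> * L\<^sup>T\<close>, and the
  adjugates of \<open>L\<close> and \<open>L\<^sup>T\<close> (their inverses, since \<open>det L = 1\<close>) diagonalise it.\<close>

text \<open>The three summands sort paths by their last step: up, level, down. Weights from an
  arbitrary commutative ring keep the summation identities free of polynomials.\<close>

fun motzkin :: "(nat \<Rightarrow> 'a::comm_ring_1) \<Rightarrow> (nat \<Rightarrow> 'a) \<Rightarrow> nat \<Rightarrow> nat \<Rightarrow> 'a" where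
  "motzkin \<beta> l 0 k = (if k = 0 then 1 else 0)"
| "motzkin \<beta> l (Suc m) k =
     (if k = 0 then 0 else motzkin \<beta> l m (k - 1)) + \<beta> k * motzkin \<beta> l m k
       + l (Suc k) * motzkin \<beta> l m (Suc k)"

lemma motzkin_eq_0: "m < k \<Longrightarrow> motzkin \<beta> l m k = 0"
  by (induction m arbitrary: k) auto

text \<open>Only the path made of up steps alone reaches height \<open>m\<close> in \<open>m\<close>
  steps.\<close>

lemma motzkin_diag: "motzkin \<beta> l m m = 1"
  by (induction m) (auto simp: motzkin_eq_0)

text \<open>Self-adjointness of the transfer matrix for the weights
  \<open>\<Prod>r=1..k. l r\<close>: an up step on one side matches a down step on the other, whose
  factor \<open>l (Suc k)\<close> makes up the difference between neighbouring weights.\<close>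

lemma motzkin_shift:
  assumes "i \<le> N" "j \<le> N"
  shows "(\<Sum>k\<le>N. motzkin \<beta> l (Suc i) k * (\<Prod>r=1..k. l r) * motzkin \<beta> l j k)
       = (\<Sum>k\<le>N. motzkin \<beta> l i k * (\<Prod>r=1..k. l r) * motzkin \<beta> l (Suc j) k)"
proof -
  let ?T = "motzkin \<beta> l" and ?L = "\<lambda>k. \<Prod>r=1..k. l r"
  define up where "up i j = (\<Sum>k<N. ?T i k * ?L (Suc k) * ?T j (Suc k))" for i j
  define level where "level i j = (\<Sum>k\<le>N. \<beta> k * ?T i k * ?L k * ?T j k)" for i j
  have L: "?L (Suc k) = l (Suc k) * ?L k" for k
    by (simp add: mult.commute)
  have up1: "(\<Sum>k\<le>N. (if k = 0 then 0 else ?T i (k - 1)) * ?L k * ?T j k) = up i j" for i j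
    unfolding up_def lessThan_Suc_atMost[symmetric] sum.lessThan_Suc_shift by simp
  have up2: "(\<Sum>k\<le>N. l (Suc k) * ?T i (Suc k) * ?L k * ?T j k) = up j i" if "i \<le> N" for i j
  proof -
    \<comment> \<open>The term at \<open>k = N\<close> contains \<open>?T i (Suc N)\<close>, which
      vanishes because \<open>i \<le> N\<close>.\<close>
    have "(\<Sum>k\<le>N. l (Suc k) * ?T i (Suc k) * ?L k * ?T j k)
        = (\<Sum>k<N. l (Suc k) * ?T i (Suc k) * ?L k * ?T j k)"
      using that by (simp add: lessThan_Suc_atMost[symmetric] motzkin_eq_0)
    then show ?thesis
      by (simp add: up_def L mult_ac)
  qed
  have expand: "(\<Sum>k\<le>N. ?T (Suc i) k * ?L k * ?T j k) = up i j + level i j + up j i"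
    if "i \<le> N" for i j
    unfolding up1[of i j, symmetric] up2[OF that, of j, symmetric] level_def
      sum.distrib[symmetric]
    by (simp add: algebra_simps)
  have "level i j = level j i"
    by (simp add: level_def mult_ac)
  moreover have "(\<Sum>k\<le>N. ?T i k * ?L k * ?T (Suc j) k) = (\<Sum>k\<le>N. ?T (Suc j) k * ?L k * ?T i k)"
    by (simp only: mult_ac)
  ultimately show ?thesis
    using expand[OF assms(1), of j] expand[OF assms(2), of i] by (simp only: add_ac)
qed

text \<open>Steps move one at a time from the first path to the second, keeping \<open>i + j\<close>
  fixed, until the first has length \<open>0\<close> and only \<open>k = 0\<close>
  contributes.\<close>

lemma motzkin_bilinear:
  assumes "i + j \<le> N"
  shows "(\<Sum>k\<le>N. motzkin \<beta> l i k * (\<Prod>r=1..k. l r) * motzkin \<beta> l j k) = motzkin \<beta> l (i + j) 0"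
  using assms
proof (induction i arbitrary: j)
  case 0
  have "(\<Sum>k\<le>N. motzkin \<beta> l 0 k * (\<Prod>r=1..k. l r) * motzkin \<beta> l j k)
      = (\<Sum>k\<le>N. if k = 0 then motzkin \<beta> l j 0 else 0)"
    by (intro sum.cong) auto
  then show ?case by simp
next
  case (Suc i)
  then show ?case
    using motzkin_shift[of i N j \<beta> l] Suc.IH[of "Suc j"] by simp
qed

text \<open>Paths of length \<open>i\<close> stay at height at most \<open>i\<close>, so summing
  beyond \<open>n\<close> adds only zeros, however large \<open>j\<close> is.\<close>

lemma motzkin_hankel:
  assumes "i \<le> n"
  shows "(\<Sum>k\<le>n. motzkin \<beta> l i k * (\<Prod>r=1..k. l r) * motzkin \<beta> l j k) = motzkin \<beta> l (i + j) 0"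
proof -
  have "(\<Sum>k\<le>n. motzkin \<beta> l i k * (\<Prod>r=1..k. l r) * motzkin \<beta> l j k)
      = (\<Sum>k\<le>n + i + j. motzkin \<beta> l i k * (\<Prod>r=1..k. l r) * motzkin \<beta> l j k)"
    using assms by (intro sum.mono_neutral_left) (auto simp: motzkin_eq_0)
  then show ?thesis
    using motzkin_bilinear[of i j "n + i + j"] by simp
qed

text \<open>The value \<open>1\<close> is the weight of an up step and the default for pairs of
  heights that no step joins.\<close>

definition step_wt :: "nat \<Rightarrow> nat \<Rightarrow> poly_b_lambda" where
  "step_wt j k = (if k = j then b j else if j = Suc k then lam j else 1)"

text \<open>With one factor per position, the last step can be split off the weight.\<close>

lemma wt_eq_prod_step: "wt m \<omega> = (\<Prod>i=1..m. step_wt (\<omega> i) (\<omega> (Suc i)))"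
proof -
  have "wt m \<omega> = (\<Prod>i=1..m. (if \<omega> (i+1) = \<omega> i then b (\<omega> i) else 1)
      * (if int (\<omega> (i+1)) - int (\<omega> i) = -1 then lam (\<omega> i) else 1))"
    unfolding wt_def prod.distrib by (simp only: prod.inter_filter finite_atLeastAtMost)
  also have "\<dots> = (\<Prod>i=1..m. step_wt (\<omega> i) (\<omega> (Suc i)))"
    by (intro prod.cong) (auto simp: step_wt_def)
  finally show ?thesis .
qed

definition motzkin_paths_to :: "nat \<Rightarrow> nat \<Rightarrow> (nat \<Rightarrow> nat) set" where
  "motzkin_paths_to m k = {\<omega> \<in> motzkin_paths m. \<omega> 1 = 0 \<and> \<omega> (m+1) = k}"

lemma motzkin_paths_to_0: "motzkin_paths_to 0 k = (if k = 0 then {\<lambda>x\<in>{1}. 0} else {})"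
  by (auto simp: motzkin_paths_to_def motzkin_paths_def PiE_iff extensional_def fun_eq_iff)

text \<open>Paths are sorted by their height \<open>j\<close> before the last step; truncated
  subtraction makes the range \<open>{0..1}\<close> when \<open>k = 0\<close>.\<close>

lemma motzkin_paths_to_Suc:
  "motzkin_paths_to (Suc m) k =
     (\<Union>j\<in>{k-1..Suc k}. (\<lambda>\<omega>. \<omega>(m+2 := k)) ` motzkin_paths_to m j)" (is "?A = ?B")
proof
  show "?A \<subseteq> ?B"
  proof
    fix \<omega> assume "\<omega> \<in> ?A"
    then have \<omega>: "\<omega> \<in> extensional {1..m+2}" "\<omega> 1 = 0" "\<omega> (m+2) = k"
      and step: "\<And>i. i \<in> {1..Suc m} \<Longrightarrow> \<bar>int (\<omega> (i+1)) - int (\<omega> i)\<bar> \<le> 1"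
      by (auto simp: motzkin_paths_to_def motzkin_paths_def PiE_iff)
    \<comment> \<open>Resetting to \<open>undefined\<close> makes the shortened path extensional on
      \<open>{1..m+1}\<close>.\<close>
    define \<omega>' where "\<omega>' = \<omega>(m+2 := undefined)"
    have "\<omega> (m+1) \<in> {k-1..Suc k}"
      using step[of "m+1"] \<omega>(3) by auto
    moreover have "\<omega>' \<in> motzkin_paths_to m (\<omega> (m+1))"
      using \<omega> step
      by (auto simp: \<omega>'_def motzkin_paths_to_def motzkin_paths_def PiE_iff extensional_def)
    moreover have "\<omega> = \<omega>'(m+2 := k)"
      using \<omega>(3) by (auto simp: \<omega>'_def)
    ultimately show "\<omega> \<in> ?B" by blast
  qed
  show "?B \<subseteq> ?A"
  proof
    fix \<omega> assume "\<omega> \<in> ?B"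
    then obtain j \<omega>' where j: "j \<in> {k-1..Suc k}" and \<omega>': "\<omega>' \<in> motzkin_paths_to m j"
      and \<omega>: "\<omega> = \<omega>'(m+2 := k)" by blast
    have "\<bar>int (\<omega> (i+1)) - int (\<omega> i)\<bar> \<le> 1" if "i \<in> {1..Suc m}" for i
    proof (cases "i = Suc m")
      case True
      then show ?thesis
        using j \<omega>' by (auto simp: \<omega> motzkin_paths_to_def)
    next
      case False
      then show ?thesis
        using \<omega>' that by (auto simp: \<omega> motzkin_paths_to_def motzkin_paths_def)
    qed
    then show "\<omega> \<in> ?A"
      using \<omega>' by (auto simp: \<omega> motzkin_paths_to_def motzkin_paths_def PiE_iff extensional_def)
  qed
qed

lemma finite_motzkin_paths_to: "finite (motzkin_paths_to m k)"
  by (induction m arbitrary: k) (auto simp: motzkin_paths_to_0 motzkin_paths_to_Suc)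

text \<open>Cutting off the last step turns the path sum into the recursion of
  \<open>motzkin\<close>.\<close>

lemma sum_wt_motzkin_paths_to: "(\<Sum>\<omega>\<in>motzkin_paths_to m k. wt m \<omega>) = motzkin b lam m k"
proof (induction m arbitrary: k)
  case 0
  then show ?case by (simp add: motzkin_paths_to_0 wt_def)
next
  case (Suc m)
  let ?ext = "\<lambda>\<omega>. \<omega>(m+2 := k) :: nat \<Rightarrow> nat"
  have wt_ext: "wt (Suc m) (?ext \<omega>) = wt m \<omega> * step_wt j k" if "\<omega> \<in> motzkin_paths_to m j" for j \<omega>
  proof -
    have "(\<Prod>i=1..m. step_wt (?ext \<omega> i) (?ext \<omega> (Suc i))) = wt m \<omega>"
      unfolding wt_eq_prod_step by (intro prod.cong) auto
    then show ?thesis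
      using that by (simp add: wt_eq_prod_step[of "Suc m"] motzkin_paths_to_def)
  qed
  have inj: "inj_on ?ext (motzkin_paths_to m j)" for j
  proof (rule inj_onI)
    fix \<omega> \<omega>' assume "\<omega> \<in> motzkin_paths_to m j" "\<omega>' \<in> motzkin_paths_to m j" "?ext \<omega> = ?ext \<omega>'"
    \<comment> \<open>Position \<open>m+2\<close> lies outside the domain of both paths, so both are
      \<open>undefined\<close> there.\<close>
    moreover from calculation have "\<omega> (m+2) = \<omega>' (m+2)"
      by (auto simp: motzkin_paths_to_def motzkin_paths_def PiE_iff extensional_def)
    ultimately show "\<omega> = \<omega>'"
      by (metis fun_upd_triv fun_upd_upd)
  qed
  have wt_image: "(\<Sum>\<omega>\<in>?ext ` motzkin_paths_to m j. wt (Suc m) \<omega>) = motzkin b lam m j * step_wt j k"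
    for j
  proof -
    have "(\<Sum>\<omega>\<in>?ext ` motzkin_paths_to m j. wt (Suc m) \<omega>)
        = (\<Sum>\<omega>\<in>motzkin_paths_to m j. wt m \<omega> * step_wt j k)"
      using wt_ext by (subst sum.reindex[OF inj]) (auto intro!: sum.cong)
    then show ?thesis
      by (simp add: Suc.IH flip: sum_distrib_right)
  qed
  have disj: "?ext ` motzkin_paths_to m i \<inter> ?ext ` motzkin_paths_to m j = {}" if "i \<noteq> j" for i j
  proof -
    \<comment> \<open>Extending leaves position \<open>m+1\<close> untouched, so \<open>j\<close>
      can be read off there.\<close>
    have "\<omega> (m+1) = j" if "\<omega> \<in> ?ext ` motzkin_paths_to m j" for \<omega> j
      using that by (auto simp: motzkin_paths_to_def)
    then show ?thesis using that by blast
  qed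
  have "(\<Sum>\<omega>\<in>motzkin_paths_to (Suc m) k. wt (Suc m) \<omega>)
      = (\<Sum>j=k-1..Suc k. \<Sum>\<omega>\<in>?ext ` motzkin_paths_to m j. wt (Suc m) \<omega>)"
    unfolding motzkin_paths_to_Suc
    by (rule sum.UNION_disjoint) (use finite_motzkin_paths_to disj in auto)
  also have "\<dots> = (\<Sum>j=k-1..Suc k. motzkin b lam m j * step_wt j k)"
    by (simp only: wt_image)
  also have "\<dots> = motzkin b lam (Suc m) k"
    by (cases k) (simp_all add: step_wt_def sum.atLeast_Suc_atMost mult.commute add.assoc)
  finally show ?case .
qed

lemma \<mu>_eq_motzkin: "\<mu> m = motzkin b lam m 0"
  by (simp add: \<mu>_def closed_motzkin_paths_def motzkin_paths_to_def
      flip: sum_wt_motzkin_paths_to)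

text \<open>As \<open>det L = 1\<close>, the adjugate of \<open>L\<close> is its inverse; it and its
  transpose, both of determinant \<open>1\<close>, cancel the outer factors of
  \<open>A\<close>.\<close>

lemma is_SSNF_mat_diagI:
  fixes A L :: "'a::comm_ring_1 mat"
  assumes L: "L \<in> carrier_mat m m" and det: "det L = 1"
    and A: "A = L * mat_diag m d * transpose_mat L"
    and dvd: "\<And>i j. j \<le> i \<Longrightarrow> i < m \<Longrightarrow> d j dvd d i"
  shows "is_SSNF A (mat_diag m d)"
proof -
  define P where "P = adj_mat L"
  have P: "P \<in> carrier_mat m m" and LP: "L * P = 1\<^sub>m m" and PL: "P * L = 1\<^sub>m m"
    using adj_mat[OF L] det by (auto simp: P_def intro!: eq_matI)
  have "det L * det P = 1"
    using det_mult[OF L P] LP by simp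
  then have detP: "det P = 1"
    using det by simp
  let ?D = "mat_diag m d"
  have D: "?D \<in> carrier_mat m m" by simp
  have "transpose_mat L * transpose_mat P = 1\<^sub>m m"
    using transpose_mult[OF P L] PL by simp
  moreover have "P * A * transpose_mat P = (P * L) * ?D * (transpose_mat L * transpose_mat P)"
    unfolding A using P L D by (simp add: assoc_mult_mat[of _ m m _ m _ m]
        mult_carrier_mat[of _ m m _ m])
  ultimately have "P * A * transpose_mat P = ?D"
    using PL D by simp
  moreover have "A \<in> carrier_mat m m"
    using L D by (auto simp: A)
  moreover have "P \<in> SL m" "transpose_mat P \<in> SL m"
    using P detP by (simp_all add: SL_def det_transpose)
  ultimately have "\<exists>P\<in>SL (dim_row A). \<exists>Q\<in>SL (dim_col A). P * A * Q = ?D"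
    by auto
  then show ?thesis
    using dvd by (auto simp: is_SSNF_def diagonal_mat_def mat_diag_def)
qed

theorem theorem3p1:
  fixes n :: nat
  shows "is_SSNF (hankel \<mu> n) (mat_diag (n+1) (\<lambda>i. \<Prod>k=1..i. lam k))"
proof (rule is_SSNF_mat_diagI)
  let ?L = "mat (n+1) (n+1) (\<lambda>(i, k). motzkin b lam i k)"
  let ?\<Lambda> = "\<lambda>i. \<Prod>k=1..i. lam k"
  show L: "?L \<in> carrier_mat (n+1) (n+1)" by simp
  have "diag_mat ?L = replicate (n+1) 1"
    by (intro nth_equalityI) (simp_all add: diag_mat_def motzkin_diag del: upt_Suc replicate_Suc)
  then show "det ?L = 1"
    using det_lower_triangular[OF _ L] by (simp add: motzkin_eq_0)
  show "?\<Lambda> j dvd ?\<Lambda> i" if "j \<le> i" for i j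
    using that by (intro prod_dvd_prod_subset) auto
  show "hankel \<mu> n = ?L * mat_diag (n+1) ?\<Lambda> * transpose_mat ?L"
  proof (rule eq_matI)
    fix i j assume "i < dim_row (?L * mat_diag (n+1) ?\<Lambda> * transpose_mat ?L)"
      "j < dim_col (?L * mat_diag (n+1) ?\<Lambda> * transpose_mat ?L)"
    then have "i \<le> n" "j \<le> n" by simp_all
    then show "hankel \<mu> n $$ (i, j) = (?L * mat_diag (n+1) ?\<Lambda> * transpose_mat ?L) $$ (i, j)"
      \<comment> \<open>The diagonal factor scales the columns of \<open>?L\<close>, so the entry
        becomes the sum in \<open>motzkin_hankel\<close>.\<close>
      unfolding mat_diag_mult_right[OF L]
      by (simp add: hankel_def scalar_prod_def \<mu>_eq_motzkin
          lessThan_Suc_atMost atLeast0LessThan flip: motzkin_hankel[of i n])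
  qed (simp_all add: hankel_def)
qed

end
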